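(* Let $E$ and $F$ be Archimedean Riesz spaces with weak order units $e\in E$ and $f\in F$, respectively. If $T:E\to F$ is a lattice homomorphism satisfying $T(\lambda e)=\lambda f$ for each $\lambda\in\mathbb{R}$, then $T$ is a Riesz homomorphism, i.e. $T$ is linear.
   Context: A map $T:E\to F$ between Riesz spaces (real vector lattices), not assumed linear, is called a lattice homomorphism if $T(x\vee y)=Tx\vee Ty$ and $T(x\wedge y)=Tx\wedge Ty$ for all $x,y\in E$. A linear lattice homomorphism is called a Riesz homomorphism. A weak order unit of a Riesz space $E$ is an element $e\ge 0$ such that $x\wedge e=0$ with $x\ge 0$ implies $x=0$. *)

theory Defs
  imports Complex_Main
begin

class riesz_space = ordered_real_vector + lattice

class archimedean_riesz_space = riesz_space +
  assumes archimedean: "0 \<le> u \<Longrightarrow> (\<And>n::nat. real n *\<^sub>R u \<le> v) \<Longrightarrow> u = 0"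

definition weak_order_unit :: "'a::riesz_space \<Rightarrow> bool" where
  "weak_order_unit e \<longleftrightarrow> 0 \<le> e \<and> (\<forall>x\<ge>0. inf x e = 0 \<longrightarrow> x = 0)"

definition lattice_homomorphism :: "('a::lattice \<Rightarrow> 'b::lattice) \<Rightarrow> bool" where
  "lattice_homomorphism T \<longleftrightarrow>
    (\<forall>x y. T (sup x y) = sup (T x) (T y) \<and> T (inf x y) = inf (T x) (T y))"

definition riesz_homomorphism :: "('a::riesz_space \<Rightarrow> 'b::riesz_space) \<Rightarrow> bool" where
  "riesz_homomorphism T \<longleftrightarrow> linear T \<and> lattice_homomorphism T"

end

(* Elements h > 0 of F replace the points of a function representation: le_on h a b says that
   a <= b on the support of h. On the support of some smaller h, every element of F is within
   epsilon of a multiple of the unit f. The key claim is that T x <= r f on h implies, for r < r',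
   T (m e + C (x - r' e)) <= m f on h for every level m and every slope C >= 0; if T were
   evaluation at a point, x would be < r' there. Subadditivity of T follows because x + y lies
   below the supremum of two such affine elements at level r' + s' with slope 2, and positive
   subhomogeneity is the claim at level a r' with slope a. The reverse inequalities follow by
   applying this to x |-> - T (- x). *)

theory Submission
  imports Defs "HOL-Library.Lattice_Algebras"
begin

section \<open>Distributivity and disjointness in lattice-ordered groups and Riesz spaces\<close>

instance lattice_ab_group_add \<subseteq> distrib_lattice
proof
  have le: "inf a (sup b c) \<le> sup (inf a b) (inf a c)" for a b c :: 'a
  proof -
    let ?s = "sup (inf a b) (inf a c)" and ?t = "sup b c"
    \<comment> \<open>Since \<open>a + d = inf a d + sup a d\<close>, a bound on
      \<open>inf a d\<close> becomes a bound on \<open>d\<close>. The bounds for \<open>b\<close>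
      and \<open>c\<close> join into one for \<open>?t\<close>, and cancelling
      \<open>sup a ?t\<close> gives the claim.\<close>
    have part: "d \<le> ?s + sup a ?t - a" if "inf a d \<le> ?s" "d \<le> ?t" for d
    proof -
      have "a + d = inf a d + sup a d"
        by (subst add_eq_inf_sup) (rule add.commute)
      also have "\<dots> \<le> ?s + sup a ?t"
        using that by (intro add_mono sup_mono) auto
      finally show ?thesis by (simp add: le_diff_eq add.commute)
    qed
    have "?t \<le> ?s + sup a ?t - a"
      by (rule sup_least; rule part) auto
    then have "a + ?t \<le> ?s + sup a ?t"
      by (simp add: le_diff_eq add.commute)
    then show ?thesis
      unfolding add_eq_inf_sup[of a ?t] by simp
  qed
  have "inf a (sup b c) = sup (inf a b) (inf a c)" for a b c :: 'a
    by (intro antisym le) (auto intro: le_infI2)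
  then show "sup x (inf y z) = inf (sup x y) (sup x z)" for x y z :: 'a
    by (rule distrib_imp1)
qed

instance riesz_space \<subseteq> lattice_ab_group_add ..

text \<open>The total weights agree, so up to that factor the infimum lies below one weighted mean
  and the supremum above the other. Linear identities thus become lattice inequalities, which a
  lattice homomorphism respects before it is known to be linear.\<close>

lemma inf_le_sup_of_combination:
  fixes a b c d :: "'a::riesz_space"
  assumes "\<alpha> *\<^sub>R a + \<beta> *\<^sub>R b \<le> \<gamma> *\<^sub>R c + \<delta> *\<^sub>R d"
    and "0 \<le> \<alpha>" "0 \<le> \<beta>" "0 \<le> \<gamma>" "0 \<le> \<delta>" "\<alpha> + \<beta> = \<gamma> + \<delta>" "0 < \<gamma> + \<delta>"
  shows "inf a b \<le> sup c d"
proof -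
  have "(\<alpha> + \<beta>) *\<^sub>R inf a b \<le> \<alpha> *\<^sub>R a + \<beta> *\<^sub>R b"
    unfolding scaleR_left_distrib using assms by (intro add_mono scaleR_left_mono) auto
  also note assms(1)
  also have "\<gamma> *\<^sub>R c + \<delta> *\<^sub>R d \<le> (\<gamma> + \<delta>) *\<^sub>R sup c d"
    unfolding scaleR_left_distrib using assms by (intro add_mono scaleR_left_mono) auto
  finally have "(\<gamma> + \<delta>) *\<^sub>R inf a b \<le> (\<gamma> + \<delta>) *\<^sub>R sup c d"
    using assms by simp
  then show ?thesis
    using assms(7) by (simp only: scaleR_le_cancel_left_pos)
qed

lemma inf_add_le:
  fixes h p q :: "'a::lattice_ab_group_add"
  assumes "0 \<le> h" "0 \<le> p" "0 \<le> q"
  shows "inf h (p + q) \<le> inf h p + inf h q"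
proof -
  have "inf h (p + q) \<le> inf (inf (h + h) (h + q)) (inf (p + h) (p + q))"
    using assms by (auto intro: le_infI1 le_infI2 add_increasing add_increasing2)
  also have "\<dots> = inf h p + inf h q"
    by (simp add: add_inf_distrib_left add_inf_distrib_right ac_simps)
  finally show ?thesis .
qed

text \<open>Disjointness survives sums by \<open>inf_add_le\<close>, hence natural multiples, and a
  real multiple lies below a natural one.\<close>

lemma disjoint_scaleR:
  fixes p q :: "'a::riesz_space"
  assumes "0 \<le> p" "0 \<le> q" "inf p q = 0" "0 \<le> k"
  shows "inf p (k *\<^sub>R q) = 0"
proof -
  have n: "inf p (real n *\<^sub>R q) = 0" for n
  proof (induction n)
    case 0
    then show ?case using assms by (simp add: inf_absorb2)
  next
    case (Suc n)
    have "inf p (real (Suc n) *\<^sub>R q) \<le> inf p q + inf p (real n *\<^sub>R q)"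
      using inf_add_le[of p q "real n *\<^sub>R q"] assms
      by (simp add: scaleR_left_distrib scaleR_nonneg_nonneg)
    then have "inf p (real (Suc n) *\<^sub>R q) \<le> 0"
      using Suc assms by simp
    moreover have "0 \<le> inf p (real (Suc n) *\<^sub>R q)"
      using assms by (simp add: scaleR_nonneg_nonneg del: of_nat_Suc)
    ultimately show ?case by (rule antisym)
  qed
  obtain n :: nat where "k \<le> real n"
    using real_arch_simple by blast
  then have "inf p (k *\<^sub>R q) \<le> inf p (real n *\<^sub>R q)"
    using assms by (intro inf_mono) (auto intro: scaleR_right_mono)
  moreover have "0 \<le> inf p (k *\<^sub>R q)"
    using assms by (simp add: scaleR_nonneg_nonneg)
  ultimately show ?thesis using n[of n] by simp
qed

lemma weak_order_unit_nonneg: "weak_order_unit f \<Longrightarrow> 0 \<le> f"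
  by (simp add: weak_order_unit_def)

lemma weak_order_unit_disjoint:
  "weak_order_unit f \<Longrightarrow> 0 \<le> h \<Longrightarrow> inf h f = 0 \<Longrightarrow> h = 0"
  by (simp add: weak_order_unit_def)

lemma nonpos_if_pprt_eq_0:
  fixes z :: "'a::lattice_ab_group_add"
  shows "pprt z = 0 \<Longrightarrow> z \<le> 0"
  by (metis pprt_def sup.cobounded1)

lemma pprt_disjoint_pprt_uminus:
  fixes z :: "'a::lattice_ab_group_add"
  shows "inf (pprt z) (pprt (- z)) = 0"
proof -
  have "inf (pprt z) (pprt (- z)) + inf z 0 = inf (pprt z + inf z 0) (pprt (-z) + inf z 0)"
    by (rule add_inf_distrib_right)
  also have "pprt z + inf z 0 = z"
    by (metis nprt_def prts)
  also have "pprt (- z) + inf z 0 = 0"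
    by (metis add.right_inverse add.commute nprt_def pprt_neg)
  finally show ?thesis by simp
qed

section \<open>Inequalities on the support of an element\<close>

definition le_on :: "'a::lattice_ab_group_add \<Rightarrow> 'a \<Rightarrow> 'a \<Rightarrow> bool" where
  "le_on h a b \<longleftrightarrow> inf h (pprt (a - b)) = 0"

lemma le_onI:
  assumes "0 \<le> h" "inf h (pprt (a - b)) \<le> 0"
  shows "le_on h a b"
  using assms unfolding le_on_def by (intro antisym) auto

lemma le_on_of_le:
  assumes "0 \<le> h" "a \<le> b" shows "le_on h a b"
proof -
  have "pprt (a - b) = 0" using assms by simp
  then show ?thesis using assms by (simp add: le_on_def inf_absorb2)
qed

text \<open>This is how supports shrink: if \<open>le_on h a b\<close> fails, the new element is
  nonzero and carries the opposite inequality.\<close>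

lemma le_on_inf_pprt:
  assumes "0 \<le> h" shows "le_on (inf h (pprt (a - b))) b a"
proof (rule le_onI)
  have "inf (inf h (pprt (a - b))) (pprt (b - a)) \<le> inf (pprt (a - b)) (pprt (- (a - b)))"
    by (auto intro: le_infI1)
  then show "inf (inf h (pprt (a - b))) (pprt (b - a)) \<le> 0"
    by (simp only: pprt_disjoint_pprt_uminus)
qed (use assms in auto)

lemma le_on_antimono:
  assumes "le_on h a b" "0 \<le> h'" "h' \<le> h" shows "le_on h' a b"
proof (rule le_onI)
  have "inf h' (pprt (a - b)) \<le> inf h (pprt (a - b))"
    using assms by (intro inf_mono) auto
  also have "\<dots> = 0" using assms by (simp add: le_on_def)
  finally show "inf h' (pprt (a - b)) \<le> 0" .
qed fact

lemma le_on_add: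
  assumes "0 \<le> h" "le_on h a b" "le_on h c d" shows "le_on h (a + c) (b + d)"
proof (rule le_onI)
  have "a + c - (b + d) \<le> pprt (a - b) + pprt (c - d)"
    using add_mono[of "a - b" "pprt (a - b)" "c - d" "pprt (c - d)"]
    by (simp add: pprt_def algebra_simps)
  then have "pprt (a + c - (b + d)) \<le> pprt (a - b) + pprt (c - d)"
    unfolding pprt_def[of "a + c - (b + d)"] by (auto intro: add_nonneg_nonneg)
  then have "inf h (pprt (a + c - (b + d))) \<le> inf h (pprt (a - b) + pprt (c - d))"
    by (intro inf_mono) auto
  also have "\<dots> \<le> inf h (pprt (a - b)) + inf h (pprt (c - d))"
    using assms by (intro inf_add_le) auto
  also have "\<dots> = 0"
    using assms by (simp add: le_on_def)
  finally show "inf h (pprt (a + c - (b + d))) \<le> 0" .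
qed fact

lemma le_on_trans:
  assumes "0 \<le> h" "le_on h a b" "le_on h b c" shows "le_on h a c"
  using le_on_add[OF assms] by (simp add: le_on_def algebra_simps)

lemma le_on_sup:
  assumes "le_on h a c" "le_on h b c" shows "le_on h (sup a b) c"
proof -
  have "sup a b - c = sup (a - c) (b - c)"
    using add_sup_distrib_right[of a b "- c"] by simp
  then have "pprt (sup a b - c) = sup (pprt (a - c)) (pprt (b - c))"
    by (simp add: pprt_def sup.assoc sup.left_commute)
  then show ?thesis
    using assms by (simp add: le_on_def inf_sup_distrib1)
qed

lemma le_on_uminus_iff: "le_on h (- a) (- b) \<longleftrightarrow> le_on h b a"
  by (simp add: le_on_def)

lemma le_on_inf:
  assumes "le_on h a b" "le_on h a c" shows "le_on h a (inf b c)"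
  using le_on_sup[of h "- b" "- a" "- c"] assms
  by (simp add: le_on_uminus_iff flip: neg_inf_eq_sup)

lemma le_on_scaleR:
  fixes a b :: "'a::riesz_space"
  assumes "0 \<le> h" "le_on h a b" "0 \<le> k" shows "le_on h (k *\<^sub>R a) (k *\<^sub>R b)"
proof (rule le_onI)
  have "k *\<^sub>R a - k *\<^sub>R b \<le> k *\<^sub>R pprt (a - b)"
    unfolding scaleR_diff_right[symmetric]
    using assms by (intro scaleR_left_mono) (auto simp: pprt_def)
  then have "pprt (k *\<^sub>R a - k *\<^sub>R b) \<le> k *\<^sub>R pprt (a - b)"
    unfolding pprt_def[of "k *\<^sub>R a - k *\<^sub>R b"] using assms by (auto intro: scaleR_nonneg_nonneg)
  then have "inf h (pprt (k *\<^sub>R a - k *\<^sub>R b)) \<le> inf h (k *\<^sub>R pprt (a - b))"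
    by (intro inf_mono) auto
  also have "\<dots> = 0"
    using assms by (intro disjoint_scaleR) (auto simp: le_on_def)
  finally show "inf h (pprt (k *\<^sub>R a - k *\<^sub>R b)) \<le> 0" .
qed fact

text \<open>The excess of \<open>a\<close> over \<open>c f\<close> on \<open>h\<close> is disjoint
  from \<open>(d - c) f\<close>, hence from \<open>f\<close>, so it vanishes because
  \<open>f\<close> is a weak order unit. The lemma removes the truncations that comparisons of
  affine elements leave behind.\<close>

lemma le_on_inf_unit_cancel:
  fixes f :: "'a::riesz_space"
  assumes f: "weak_order_unit f" and h: "0 \<le> h" and "c < d"
    and le: "le_on h (inf a (d *\<^sub>R f)) (c *\<^sub>R f)"
  shows "le_on h a (c *\<^sub>R f)"
proof -
  let ?p = "inf h (pprt (a - c *\<^sub>R f))"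
  have "inf a (d *\<^sub>R f) - c *\<^sub>R f = inf (a - c *\<^sub>R f) ((d - c) *\<^sub>R f)"
    using add_inf_distrib_right[of a "d *\<^sub>R f" "- (c *\<^sub>R f)"] by (simp add: scaleR_left_diff_distrib)
  then have "pprt (inf a (d *\<^sub>R f) - c *\<^sub>R f) = inf (pprt (a - c *\<^sub>R f)) (pprt ((d - c) *\<^sub>R f))"
    by (simp add: pprt_def sup_inf_distrib2)
  also have "pprt ((d - c) *\<^sub>R f) = (d - c) *\<^sub>R f"
    using \<open>c < d\<close> weak_order_unit_nonneg[OF f] by (simp add: scaleR_nonneg_nonneg)
  finally have "inf ?p ((d - c) *\<^sub>R f) = 0"
    using le by (simp add: le_on_def inf_assoc)
  moreover have p: "0 \<le> ?p"
    using h by simp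
  moreover have "0 \<le> (d - c) *\<^sub>R f" "0 \<le> 1 / (d - c)"
    using h \<open>c < d\<close> weak_order_unit_nonneg[OF f] by (auto intro: scaleR_nonneg_nonneg)
  ultimately have "inf ?p ((1 / (d - c)) *\<^sub>R ((d - c) *\<^sub>R f)) = 0"
    using disjoint_scaleR[of ?p "(d - c) *\<^sub>R f" "1 / (d - c)"] by blast
  then have "inf ?p f = 0" using \<open>c < d\<close> by simp
  then have "?p = 0" using weak_order_unit_disjoint[OF f p] by blast
  then show ?thesis by (simp add: le_on_def)
qed

section \<open>Local approximation by multiples of the unit\<close>

text \<open>Otherwise \<open>X\<close> dominates every \<open>n f\<close> on \<open>h\<close>, which
  forces \<open>n (inf h f)\<close> below the positive part of \<open>X\<close> for all
  \<open>n\<close>. The Archimedean property then gives \<open>inf h f = 0\<close>, contradicting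
  that \<open>f\<close> is a weak order unit.\<close>

lemma locally_bounded_above:
  fixes f :: "'a::archimedean_riesz_space"
  assumes f: "weak_order_unit f" and h: "0 \<le> h" "h \<noteq> 0"
  obtains h' n where "0 \<le> h'" "h' \<le> h" "h' \<noteq> 0" "le_on h' X (real n *\<^sub>R f)"
proof -
  have "\<exists>n::nat. inf h (pprt (real n *\<^sub>R f - X)) \<noteq> 0"
  proof (rule ccontr)
    assume "\<not> ?thesis"
    then have X: "inf h (pprt (real n *\<^sub>R f - X)) = 0" for n by blast
    have "real n *\<^sub>R inf h f \<le> pprt X" for n
    proof (cases "n = 0")
      case False
      then have n: "0 < real n" by simp
      have "f = (1 / n) *\<^sub>R (real n *\<^sub>R f - X) + (1 / n) *\<^sub>R X"
        using n by (simp add: scaleR_diff_right)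
      also have "\<dots> \<le> (1 / n) *\<^sub>R pprt (real n *\<^sub>R f - X) + (1 / n) *\<^sub>R pprt X"
        using n by (intro add_mono scaleR_left_mono) (auto simp: pprt_def)
      finally have "inf h f \<le>
          inf h ((1 / n) *\<^sub>R pprt (real n *\<^sub>R f - X) + (1 / n) *\<^sub>R pprt X)"
        by (intro inf_mono) auto
      also have "\<dots> \<le>
          inf h ((1 / n) *\<^sub>R pprt (real n *\<^sub>R f - X)) + inf h ((1 / n) *\<^sub>R pprt X)"
        using h n by (intro inf_add_le) (auto intro: scaleR_nonneg_nonneg)
      also have "inf h ((1 / n) *\<^sub>R pprt (real n *\<^sub>R f - X)) = 0"
        using h X by (intro disjoint_scaleR) auto
      also have "0 + inf h ((1 / n) *\<^sub>R pprt X) \<le> (1 / n) *\<^sub>R pprt X"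
        by simp
      finally have "real n *\<^sub>R inf h f \<le> real n *\<^sub>R ((1 / n) *\<^sub>R pprt X)"
        using n by (intro scaleR_left_mono) auto
      then show ?thesis using n by simp
    qed simp
    then have "inf h f = 0"
      using h weak_order_unit_nonneg[OF f] by (intro archimedean) auto
    then show False using weak_order_unit_disjoint[OF f] h by blast
  qed
  then obtain n :: nat where n: "inf h (pprt (real n *\<^sub>R f - X)) \<noteq> 0" by blast
  let ?h = "inf h (pprt (real n *\<^sub>R f - X))"
  have "le_on ?h X (real n *\<^sub>R f)"
    using h(1) by (rule le_on_inf_pprt)
  then show ?thesis
    using that[of ?h n] n h by simp
qed

text \<open>The range of \<open>X\<close> is cut into \<open>k\<close> slabs of height \<epsilon>.
  Either \<open>X\<close> stays below the top slab on \<open>h\<close>, and one slab is dropped, or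
  \<open>h\<close> shrinks to a nonzero element on which \<open>X\<close> lies in the top
  slab.\<close>

lemma locally_almost_constant_aux:
  fixes f :: "'a::riesz_space"
  assumes "0 \<le> h" "h \<noteq> 0" "le_on h (c *\<^sub>R f) X" "le_on h X ((c + real k * \<epsilon>) *\<^sub>R f)" "0 < \<epsilon>"
    and "0 \<le> f"
  shows "\<exists>h' r. 0 \<le> h' \<and> h' \<le> h \<and> h' \<noteq> 0 \<and>
    le_on h' (r *\<^sub>R f) X \<and> le_on h' X ((r + \<epsilon>) *\<^sub>R f)"
  using assms(4)
proof (induction k)
  case 0
  have "le_on h (c *\<^sub>R f) ((c + \<epsilon>) *\<^sub>R f)"
    using assms by (intro le_on_of_le scaleR_right_mono) auto
  with 0 have "le_on h X ((c + \<epsilon>) *\<^sub>R f)"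
    using le_on_trans[OF \<open>0 \<le> h\<close>] by simp
  then show ?case using assms by blast
next
  case (Suc k)
  define r where "r = c + real k * \<epsilon>"
  let ?h = "inf h (pprt (X - r *\<^sub>R f))"
  show ?case
  proof (cases "?h = 0")
    case True
    then have "le_on h X (r *\<^sub>R f)" by (simp add: le_on_def)
    then show ?thesis using Suc.IH by (simp add: r_def)
  next
    case False
    have "le_on ?h (r *\<^sub>R f) X"
      using assms(1) by (rule le_on_inf_pprt)
    moreover have "c + real (Suc k) * \<epsilon> = r + \<epsilon>"
      by (simp add: r_def algebra_simps)
    then have "le_on ?h X ((r + \<epsilon>) *\<^sub>R f)"
      using le_on_antimono[OF Suc.prems, of ?h] assms(1) by simp
    moreover have "0 \<le> ?h" "?h \<le> h"
      using assms(1) by auto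
    ultimately show ?thesis using False by blast
  qed
qed

lemma locally_almost_constant:
  fixes f :: "'a::archimedean_riesz_space"
  assumes f: "weak_order_unit f" and h: "0 \<le> h" "h \<noteq> 0" and "0 < \<epsilon>"
  obtains h' r where "0 \<le> h'" "h' \<le> h" "h' \<noteq> 0"
    "le_on h' (r *\<^sub>R f) X" "le_on h' X ((r + \<epsilon>) *\<^sub>R f)"
proof -
  obtain h1 n where h1: "0 \<le> h1" "h1 \<le> h" "h1 \<noteq> 0" "le_on h1 X (real n *\<^sub>R f)"
    using locally_bounded_above[OF f h] .
  obtain h2 m where h2: "0 \<le> h2" "h2 \<le> h1" "h2 \<noteq> 0" "le_on h2 (- X) (real m *\<^sub>R f)"
    using locally_bounded_above[OF f h1(1,3)] .
  \<comment> \<open>Enough slabs of height \<epsilon> to cover the interval from \<open>- m\<close>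
    to \<open>n\<close>.\<close>
  obtain k :: nat where k: "(real n + real m) / \<epsilon> \<le> real k"
    using real_arch_simple by blast
  have lower: "le_on h2 ((- real m) *\<^sub>R f) X"
    using h2(4) le_on_uminus_iff[of h2 X "(- real m) *\<^sub>R f"] by simp
  have "le_on h2 (real n *\<^sub>R f) ((- real m + real k * \<epsilon>) *\<^sub>R f)"
    using k \<open>0 < \<epsilon>\<close> weak_order_unit_nonneg[OF f] h2(1)
    by (intro le_on_of_le scaleR_right_mono) (auto simp: field_simps)
  with le_on_antimono[OF h1(4) h2(1,2)]
  have "le_on h2 X ((- real m + real k * \<epsilon>) *\<^sub>R f)"
    using le_on_trans[OF h2(1)] by blast
  from locally_almost_constant_aux[OF h2(1,3) lower this \<open>0 < \<epsilon>\<close> weak_order_unit_nonneg[OF f]]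
  obtain h3 r where h3: "0 \<le> h3" "h3 \<le> h2" "h3 \<noteq> 0"
    "le_on h3 (r *\<^sub>R f) X" "le_on h3 X ((r + \<epsilon>) *\<^sub>R f)" by blast
  have "h3 \<le> h" using h3(2) h2(2) h1(2) by (meson order_trans)
  then show thesis using that[OF h3(1) _ h3(3-5)] by blast
qed

text \<open>If \<open>z\<close> exceeded \<epsilon> times \<open>f\<close>, the positive part of the
  difference would have a nonzero minorant \<open>h'\<close> disjoint from it, which is absurd.
  Letting \<epsilon> run through \<open>1 / n\<close>, the Archimedean property finishes.\<close>

lemma nonpos_if_locally_small:
  fixes z f :: "'a::archimedean_riesz_space"
  assumes f: "weak_order_unit f"
    and small: "\<And>h \<epsilon>. 0 \<le> h \<Longrightarrow> h \<noteq> 0 \<Longrightarrow> 0 < \<epsilon> \<Longrightarrow>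
      \<exists>h'. 0 \<le> h' \<and> h' \<le> h \<and> h' \<noteq> 0 \<and> le_on h' z (\<epsilon> *\<^sub>R f)"
  shows "z \<le> 0"
proof -
  have eps: "z \<le> \<epsilon> *\<^sub>R f" if "0 < \<epsilon>" for \<epsilon>
  proof (rule ccontr)
    assume "\<not> z \<le> \<epsilon> *\<^sub>R f"
    then have "pprt (z - \<epsilon> *\<^sub>R f) \<noteq> 0"
      using nonpos_if_pprt_eq_0[of "z - \<epsilon> *\<^sub>R f"] by auto
    from small[OF zero_le_pprt this that] obtain h' where
      h': "0 \<le> h'" "h' \<le> pprt (z - \<epsilon> *\<^sub>R f)" "h' \<noteq> 0" "le_on h' z (\<epsilon> *\<^sub>R f)" by blast
    then show False by (simp add: le_on_def inf_absorb1)
  qed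
  have "real n *\<^sub>R pprt z \<le> f" for n
  proof (cases "n = 0")
    case True
    then show ?thesis using weak_order_unit_nonneg[OF f] by simp
  next
    case False
    then have "pprt z \<le> (1 / real n) *\<^sub>R f"
      using eps[of "1 / real n"] weak_order_unit_nonneg[OF f]
      by (simp add: pprt_def scaleR_nonneg_nonneg)
    then have "real n *\<^sub>R pprt z \<le> real n *\<^sub>R ((1 / real n) *\<^sub>R f)"
      by (intro scaleR_left_mono) auto
    then show ?thesis using False by simp
  qed
  then have "pprt z = 0" using archimedean[OF zero_le_pprt] by blast
  then show ?thesis by (rule nonpos_if_pprt_eq_0)
qed

section \<open>Lattice homomorphisms preserving multiples of the unit\<close>

text \<open>A locale, so that the one-sided estimates can be instantiated a second time at the map
  of \<open>dual\<close>.\<close>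

locale unital_lattice_hom =
  fixes T :: "'a::riesz_space \<Rightarrow> 'b::archimedean_riesz_space" and e :: 'a and f :: 'b
  assumes unit: "weak_order_unit f"
    and hom: "lattice_homomorphism T"
    and T_unit: "\<And>c. T (c *\<^sub>R e) = c *\<^sub>R f"
begin

lemma T_sup: "T (sup x y) = sup (T x) (T y)" and T_inf: "T (inf x y) = inf (T x) (T y)"
  using hom by (auto simp: lattice_homomorphism_def)

lemma T_mono: "x \<le> y \<Longrightarrow> T x \<le> T y"
  by (metis T_sup le_iff_sup)

lemma unit_mono: "c \<le> d \<Longrightarrow> c *\<^sub>R f \<le> d *\<^sub>R f"
  using weak_order_unit_nonneg[OF unit] by (simp add: scaleR_right_mono)

text \<open>Everything in \<open>E\<close> is compared by convex combinations of affine elements, since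
  \<open>inf a b \<le> \<alpha> a + \<beta> b\<close> and \<open>\<gamma> c + \<delta> d \<le> sup c d\<close>; no points of \<open>E\<close> are needed.\<close>

lemma affine_upper_same_level:
  assumes h: "0 \<le> h" and x: "le_on h (T x) (r *\<^sub>R f)" and "r < r'" "0 \<le> C"
  shows "le_on h (T (r *\<^sub>R e + C *\<^sub>R (x - r' *\<^sub>R e))) (r *\<^sub>R f)"
proof -
  let ?w = "r *\<^sub>R e + C *\<^sub>R (x - r' *\<^sub>R e)"
  \<comment> \<open>Pointwise: where \<open>x \<le> r'\<close>, \<open>?w\<close> is at most
    \<open>r\<close>; elsewhere \<open>r'\<close> is below \<open>x\<close>. So \<open>?w\<close>
    truncated at \<open>r'\<close> stays below the supremum of \<open>x\<close> and
    \<open>r\<close>.\<close>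
  have "1 *\<^sub>R ?w + C *\<^sub>R (r' *\<^sub>R e) \<le> C *\<^sub>R x + 1 *\<^sub>R (r *\<^sub>R e)"
    by (simp add: algebra_simps)
  then have "inf ?w (r' *\<^sub>R e) \<le> sup x (r *\<^sub>R e)"
    using \<open>0 \<le> C\<close> by (intro inf_le_sup_of_combination[of 1 _ C _ C _ 1]) auto
  from T_mono[OF this] have "le_on h (inf (T ?w) (r' *\<^sub>R f)) (sup (T x) (r *\<^sub>R f))"
    using h by (intro le_on_of_le) (auto simp: T_inf T_sup T_unit)
  moreover have "le_on h (sup (T x) (r *\<^sub>R f)) (r *\<^sub>R f)"
    using le_on_sup[OF x le_on_of_le[OF h order_refl]] .
  ultimately show ?thesis
    using le_on_inf_unit_cancel[OF unit h \<open>r < r'\<close>] le_on_trans[OF h] by blast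
qed

text \<open>Reduction to level \<open>r\<close>: where \<open>?v\<close> exceeds \<open>m\<close>,
  \<open>x\<close> exceeds \<open>r'\<close>, and there the steeper \<open>?w\<close> with the
  earlier threshold \<open>s\<close> exceeds \<open>m + 1\<close>. The slope \<open>D\<close> makes
  \<open>?w\<close> equal \<open>m + 1\<close> at \<open>x = r'\<close>.\<close>

lemma affine_upper_higher_level:
  assumes h: "0 \<le> h" and x: "le_on h (T x) (r *\<^sub>R f)" and "r < r'" "0 \<le> C" "r \<le> m"
  shows "le_on h (T (m *\<^sub>R e + C *\<^sub>R (x - r' *\<^sub>R e))) (m *\<^sub>R f)"
proof -
  let ?v = "m *\<^sub>R e + C *\<^sub>R (x - r' *\<^sub>R e)"
  define s where "s = (r + r') / 2"
  have s: "r < s" "s < r'" using \<open>r < r'\<close> by (auto simp: s_def field_simps)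
  define D where "D = (m + 1 - r) / (r' - s)"
  have D: "0 < D" "D * (r' - s) = m + 1 - r"
    using s \<open>r \<le> m\<close> by (auto simp: D_def)
  \<comment> \<open>An element steep enough to exceed \<open>m + 1\<close> wherever the given one exceeds \<open>m\<close>.\<close>
  let ?w = "r *\<^sub>R e + D *\<^sub>R (x - s *\<^sub>R e)"
  have "D *\<^sub>R ?v + C *\<^sub>R ((m + 1) *\<^sub>R e) - (C *\<^sub>R ?w + D *\<^sub>R (m *\<^sub>R e)) =
      (C * (m + 1 - r - D * (r' - s))) *\<^sub>R e"
    by (simp add: algebra_simps)
  also have "\<dots> = 0" using D by simp
  finally have "inf ?v ((m + 1) *\<^sub>R e) \<le> sup ?w (m *\<^sub>R e)"
    using \<open>0 \<le> C\<close> D(1) by (intro inf_le_sup_of_combination[of D _ C _ C _ D]) auto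
  from T_mono[OF this] have "le_on h (inf (T ?v) ((m + 1) *\<^sub>R f)) (sup (T ?w) (m *\<^sub>R f))"
    using h by (intro le_on_of_le) (auto simp: T_inf T_sup T_unit)
  moreover have "le_on h (T ?w) (r *\<^sub>R f)"
    using D(1) by (intro affine_upper_same_level[OF h x s(1)]) auto
  then have "le_on h (T ?w) (m *\<^sub>R f)"
    using le_on_trans[OF h] le_on_of_le[OF h unit_mono[OF \<open>r \<le> m\<close>]] by blast
  then have "le_on h (sup (T ?w) (m *\<^sub>R f)) (m *\<^sub>R f)"
    using h by (intro le_on_sup) (auto intro: le_on_of_le)
  ultimately show ?thesis
    using le_on_inf_unit_cancel[OF unit h less_add_one] le_on_trans[OF h] by blast
qed

text \<open>An auxiliary \<open>?q\<close> separates the cases: \<open>inf ?q ?v\<close> is at most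
  \<open>m\<close> and \<open>sup ?q x\<close> at least \<open>s\<close> everywhere. As
  \<open>T x\<close> is at most \<open>r < s\<close> on \<open>h\<close>, \<open>T ?q\<close> is at
  least \<open>s\<close> there, which pushes \<open>T ?v\<close> down to \<open>m\<close>.\<close>

lemma affine_upper_lower_level:
  assumes h: "0 \<le> h" and x: "le_on h (T x) (r *\<^sub>R f)" and "r < r'" "0 \<le> C" "m \<le> r"
  shows "le_on h (T (m *\<^sub>R e + C *\<^sub>R (x - r' *\<^sub>R e))) (m *\<^sub>R f)"
proof -
  let ?v = "m *\<^sub>R e + C *\<^sub>R (x - r' *\<^sub>R e)"
  define s where "s = (r + r') / 2"
  have s: "r < s" "s < r'" using \<open>r < r'\<close> by (auto simp: s_def field_simps)
  define D where "D = (s - m) / (r' - s)"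
  have D: "0 < D" "D * (r' - s) = s - m"
    using s \<open>m \<le> r\<close> by (auto simp: D_def)
  \<comment> \<open>Decreasing in \<open>x\<close>: at least \<open>s\<close> where \<open>x \<le> s\<close>, and at most \<open>m\<close> where \<open>x \<ge> r'\<close>.\<close>
  let ?q = "s *\<^sub>R e - D *\<^sub>R (x - s *\<^sub>R e)"
  have "C *\<^sub>R ?q + D *\<^sub>R ?v - (C *\<^sub>R (m *\<^sub>R e) + D *\<^sub>R (m *\<^sub>R e)) =
      (C * (s - m - D * (r' - s))) *\<^sub>R e"
    by (simp add: algebra_simps)
  also have "\<dots> = 0" using D by simp
  finally have "inf ?q ?v \<le> sup (m *\<^sub>R e) (m *\<^sub>R e)"
    using \<open>0 \<le> C\<close> D(1) by (intro inf_le_sup_of_combination[of C _ D _ C _ D]) auto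
  from T_mono[OF this] have qv: "inf (T ?v) (T ?q) \<le> m *\<^sub>R f"
    by (simp add: T_inf T_unit inf_commute)
  have "1 *\<^sub>R (s *\<^sub>R e) + D *\<^sub>R (s *\<^sub>R e) \<le> 1 *\<^sub>R ?q + D *\<^sub>R x"
    by (simp add: algebra_simps)
  then have "inf (s *\<^sub>R e) (s *\<^sub>R e) \<le> sup ?q x"
    using D(1) by (intro inf_le_sup_of_combination[of 1 _ D _ 1 _ D]) auto
  from T_mono[OF this] have qx: "s *\<^sub>R f \<le> sup (T ?q) (T x)"
    by (simp add: T_sup T_unit)
  have "le_on h (sup (T ?q) (T x)) (sup (T ?q) (r *\<^sub>R f))"
    using le_on_sup[OF le_on_of_le[OF h sup_ge1] le_on_trans[OF h x le_on_of_le[OF h sup_ge2]]] .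
  with le_on_of_le[OF h qx] have "le_on h (s *\<^sub>R f) (sup (T ?q) (r *\<^sub>R f))"
    using le_on_trans[OF h] by blast
  \<comment> \<open>Negation turns the supremum with \<open>r f\<close> into a truncation, which
    cancels because \<open>- s < - r\<close>.\<close>
  then have "le_on h (inf (- T ?q) ((- r) *\<^sub>R f)) ((- s) *\<^sub>R f)"
    using le_on_uminus_iff[of h "sup (T ?q) (r *\<^sub>R f)"] by simp
  then have "le_on h (- T ?q) ((- s) *\<^sub>R f)"
    by (rule le_on_inf_unit_cancel[OF unit h, rotated]) (use s in simp)
  then have "le_on h (s *\<^sub>R f) (T ?q)"
    using le_on_uminus_iff[of h "T ?q"] by simp
  then have "le_on h (inf (T ?v) (s *\<^sub>R f)) (inf (T ?v) (T ?q))"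
    by (rule le_on_inf[OF le_on_of_le[OF h inf_le1] le_on_trans[OF h le_on_of_le[OF h inf_le2]]])
  with le_on_of_le[OF h qv] have "le_on h (inf (T ?v) (s *\<^sub>R f)) (m *\<^sub>R f)"
    using le_on_trans[OF h] by blast
  then show ?thesis
    by (rule le_on_inf_unit_cancel[OF unit h, rotated]) (use s \<open>m \<le> r\<close> in simp)
qed

lemma affine_upper:
  assumes "0 \<le> h" "le_on h (T x) (r *\<^sub>R f)" "r < r'" "0 \<le> C"
  shows "le_on h (T (m *\<^sub>R e + C *\<^sub>R (x - r' *\<^sub>R e))) (m *\<^sub>R f)"
  using affine_upper_higher_level[OF assms] affine_upper_lower_level[OF assms]
  by (meson linear)

section \<open>Subadditivity, positive homogeneity and linearity\<close>

lemma add_le: "T (x + y) \<le> T x + T y"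
proof -
  have "T (x + y) - (T x + T y) \<le> 0"
  proof (rule nonpos_if_locally_small[OF unit])
    fix h :: 'b and \<epsilon> :: real assume h: "0 \<le> h" "h \<noteq> 0" and "0 < \<epsilon>"
    then have \<delta>: "0 < \<epsilon> / 4" by simp
    obtain h1 r where h1: "0 \<le> h1" "h1 \<le> h" "h1 \<noteq> 0"
      "le_on h1 (r *\<^sub>R f) (T x)" "le_on h1 (T x) ((r + \<epsilon> / 4) *\<^sub>R f)"
      using locally_almost_constant[OF unit h \<delta>] .
    obtain h2 s where h2: "0 \<le> h2" "h2 \<le> h1" "h2 \<noteq> 0"
      "le_on h2 (s *\<^sub>R f) (T y)" "le_on h2 (T y) ((s + \<epsilon> / 4) *\<^sub>R f)"
      using locally_almost_constant[OF unit h1(1,3) \<delta>] .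
    note x = h1(4,5)[THEN le_on_antimono, OF h2(1,2)]
    \<comment> \<open>Strictly above the local upper bounds, as \<open>affine_upper\<close>
      requires; the two gaps above \<open>r\<close> and \<open>s\<close> add up to
      \<epsilon>.\<close>
    define r' s' where "r' = r + \<epsilon> / 2" and "s' = s + \<epsilon> / 2"
    let ?u = "(r' + s') *\<^sub>R e + 2 *\<^sub>R (x - r' *\<^sub>R e)"
    let ?v = "(r' + s') *\<^sub>R e + 2 *\<^sub>R (y - s' *\<^sub>R e)"
    \<comment> \<open>Slope 2 makes \<open>x + y\<close> exactly the mean of \<open>?u\<close> and
      \<open>?v\<close>.\<close>
    have "1 *\<^sub>R (x + y) + 1 *\<^sub>R (x + y) \<le> 1 *\<^sub>R ?u + 1 *\<^sub>R ?v"
      unfolding scaleR_2 scaleR_left_distrib by (simp add: algebra_simps)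
    then have "inf (x + y) (x + y) \<le> sup ?u ?v"
      by (rule inf_le_sup_of_combination) auto
    from T_mono[OF this] have "le_on h2 (T (x + y)) (sup (T ?u) (T ?v))"
      using h2 by (intro le_on_of_le) (auto simp: T_sup)
    moreover have "le_on h2 (T ?u) ((r' + s') *\<^sub>R f)" "le_on h2 (T ?v) ((r' + s') *\<^sub>R f)"
      using affine_upper[OF h2(1) x(2), of r' 2] affine_upper[OF h2(1,5), of s' 2] \<open>0 < \<epsilon>\<close>
      by (auto simp: r'_def s'_def)
    ultimately have "le_on h2 (T (x + y)) ((r' + s') *\<^sub>R f)"
      using le_on_trans[OF h2(1) _ le_on_sup] by blast
    moreover have "le_on h2 (- (T x + T y)) (- (r *\<^sub>R f + s *\<^sub>R f))"
      unfolding le_on_uminus_iff using le_on_add[OF h2(1) x(1) h2(4)] .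
    ultimately have "le_on h2 (T (x + y) + - (T x + T y))
        ((r' + s') *\<^sub>R f + - (r *\<^sub>R f + s *\<^sub>R f))"
      by (rule le_on_add[OF h2(1)])
    moreover have "(r' + s') *\<^sub>R f + - (r *\<^sub>R f + s *\<^sub>R f) = (r' + s' - (r + s)) *\<^sub>R f"
      by (simp add: algebra_simps)
    moreover have "r' + s' - (r + s) = \<epsilon>"
      by (simp add: r'_def s'_def)
    ultimately have "le_on h2 (T (x + y) - (T x + T y)) (\<epsilon> *\<^sub>R f)"
      by (simp only: add_uminus_conv_diff)
    then show "\<exists>h'. 0 \<le> h' \<and> h' \<le> h \<and> h' \<noteq> 0 \<and> le_on h' (T (x + y) - (T x + T y)) (\<epsilon> *\<^sub>R f)"
      using h2(1,3) order_trans[OF h2(2) h1(2)] by blast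
  qed
  then show ?thesis by simp
qed

lemma scaleR_le:
  assumes "0 \<le> a" shows "T (a *\<^sub>R x) \<le> a *\<^sub>R T x"
proof -
  have "T (a *\<^sub>R x) - a *\<^sub>R T x \<le> 0"
  proof (rule nonpos_if_locally_small[OF unit])
    fix h :: 'b and \<epsilon> :: real assume h: "0 \<le> h" "h \<noteq> 0" and "0 < \<epsilon>"
    \<comment> \<open>Dividing by \<open>a + 1\<close> keeps \<delta> positive and defined also for
      \<open>a = 0\<close>.\<close>
    define \<delta> where "\<delta> = \<epsilon> / (a + 1)"
    have \<delta>: "0 < \<delta>" "a * \<delta> \<le> \<epsilon>"
      using assms \<open>0 < \<epsilon>\<close> by (auto simp: \<delta>_def field_simps)
    obtain h1 r where h1: "0 \<le> h1" "h1 \<le> h" "h1 \<noteq> 0"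
      "le_on h1 (r *\<^sub>R f) (T x)" "le_on h1 (T x) ((r + \<delta> / 2) *\<^sub>R f)"
      using locally_almost_constant[OF unit h half_gt_zero[OF \<delta>(1)]] .
    define r' where "r' = r + \<delta>"
    \<comment> \<open>The multiple is itself an affine element, so \<open>affine_upper\<close>
      applies without any supremum.\<close>
    have "a *\<^sub>R x = (a * r') *\<^sub>R e + a *\<^sub>R (x - r' *\<^sub>R e)"
      by (simp add: algebra_simps)
    then have "le_on h1 (T (a *\<^sub>R x)) ((a * r') *\<^sub>R f)"
      using affine_upper[OF h1(1,5), of r' a "a * r'"] assms \<delta> by (simp add: r'_def)
    moreover have "le_on h1 (- (a *\<^sub>R T x)) (- (a *\<^sub>R (r *\<^sub>R f)))"
      unfolding le_on_uminus_iff using le_on_scaleR[OF h1(1,4) assms] .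
    ultimately have "le_on h1 (T (a *\<^sub>R x) + - (a *\<^sub>R T x)) ((a * r') *\<^sub>R f + - (a *\<^sub>R (r *\<^sub>R f)))"
      by (rule le_on_add[OF h1(1)])
    moreover have "(a * r') *\<^sub>R f + - (a *\<^sub>R (r *\<^sub>R f)) = (a * \<delta>) *\<^sub>R f"
      by (simp add: r'_def algebra_simps)
    ultimately have "le_on h1 (T (a *\<^sub>R x) - a *\<^sub>R T x) ((a * \<delta>) *\<^sub>R f)"
      by simp
    then have "le_on h1 (T (a *\<^sub>R x) - a *\<^sub>R T x) (\<epsilon> *\<^sub>R f)"
      by (rule le_on_trans[OF h1(1) _ le_on_of_le[OF h1(1) unit_mono[OF \<delta>(2)]]])
    then show "\<exists>h'. 0 \<le> h' \<and> h' \<le> h \<and> h' \<noteq> 0 \<and> le_on h' (T (a *\<^sub>R x) - a *\<^sub>R T x) (\<epsilon> *\<^sub>R f)"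
      using h1 by blast
  qed
  then show ?thesis by simp
qed

text \<open>The two negations swap \<open>sup\<close> and \<open>inf\<close> twice. Upper estimates
  for this map are lower estimates for \<open>T\<close>.\<close>

lemma dual: "unital_lattice_hom (\<lambda>x. - T (- x)) e f"
proof
  show "lattice_homomorphism (\<lambda>x. - T (- x))"
    by (simp add: lattice_homomorphism_def T_sup T_inf)
  show "- T (- (c *\<^sub>R e)) = c *\<^sub>R f" for c
    using T_unit[of "- c"] by simp
qed (rule unit)

lemma linear_T: "linear T"
proof (rule linearI)
  show add: "T (x + y) = T x + T y" for x y
  proof (rule antisym)
    have "- T (- (- x + - y)) \<le> - T (- (- x)) + - T (- (- y))"
      by (rule unital_lattice_hom.add_le[OF dual])
    then have "- T (x + y) \<le> - (T x + T y)"
      by (simp add: add.commute)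
    then show "T x + T y \<le> T (x + y)" by (simp only: neg_le_iff_le)
  qed (rule add_le)
  have nonneg: "T (a *\<^sub>R x) = a *\<^sub>R T x" if "0 \<le> a" for a x
    using scaleR_le[OF that, of x] unital_lattice_hom.scaleR_le[OF dual that, of "- x"]
    by simp
  \<comment> \<open>Additivity together with \<open>T 0 = 0\<close>, the case \<open>c = 0\<close>
    of \<open>T_unit\<close>.\<close>
  have minus: "T (- x) = - T x" for x
    using add[of x "- x"] T_unit[of 0] by (simp add: eq_neg_iff_add_eq_0 add.commute)
  show "T (a *\<^sub>R x) = a *\<^sub>R T x" for a x
  proof (cases "0 \<le> a")
    case False
    then have "T ((- a) *\<^sub>R x) = (- a) *\<^sub>R T x" by (intro nonneg) auto
    then show ?thesis using minus[of "a *\<^sub>R x"] by simp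
  qed (rule nonneg)
qed

end

theorem theorem7:
  fixes T :: "'a::archimedean_riesz_space \<Rightarrow> 'b::archimedean_riesz_space"
    and e :: 'a and f :: 'b
  assumes "weak_order_unit e"
    and "weak_order_unit f"
    and "lattice_homomorphism T"
    and "\<And>c::real. T (c *\<^sub>R e) = c *\<^sub>R f"
  shows "riesz_homomorphism T"
proof -
  interpret unital_lattice_hom T e f
    using assms by unfold_locales
  show ?thesis
    using linear_T hom by (simp add: riesz_homomorphism_def)
qed

end
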